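(* There exist piecewise rigid functions $g,h:\mathbb{R}\to\mathbb{R}$ and a partition of the real line into four pairwise disjoint subsets, $\mathbb{R}=A\sqcup B\sqcup C\sqcup D$, such that \[A\sqcup g(B)=\mathbb{R}\quad\text{and}\quad C\sqcup h(D)=\mathbb{R}.\]
   Context: A function $f:\mathbb{R}\to\mathbb{R}$ is called piecewise rigid if: (1) $f$ is a bijection; (2) $f$ is differentiable with $|f'(x)|=1$, except at a countable number of jump discontinuities; and (3) the set of discontinuities of $f$ has no limit points in $\mathbb{R}$. The symbol $\sqcup$ denotes disjoint union: an equality $X\sqcup Y=Z$ means $X\cap Y=\emptyset$ and $X\cup Y=Z$. For a set $S\subseteq\mathbb{R}$, $f(S)$ is the image of $S$ under $f$. *)

theory Defs
  imports "HOL-Analysis.Analysis"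
begin

text \<open>Both one-sided limits exist (in the reals) and differ; the value of the function at the
  point itself is unconstrained.\<close>

definition jump_discontinuity :: "(real \<Rightarrow> real) \<Rightarrow> real \<Rightarrow> bool" where
  "jump_discontinuity f x \<longleftrightarrow>
     (\<exists>l r. (f \<longlongrightarrow> l) (at_left x) \<and> (f \<longlongrightarrow> r) (at_right x) \<and> l \<noteq> r)"

text \<open>``Countable'' includes finite and empty exceptional sets, so isometries are piecewise rigid.\<close>

definition piecewise_rigid :: "(real \<Rightarrow> real) \<Rightarrow> bool" where
  "piecewise_rigid f \<longleftrightarrow>
     bij f \<and>
     (\<exists>E. countable E \<and>
        (\<forall>x\<in>E. jump_discontinuity f x) \<and>
        (\<forall>x. x \<notin> E \<longrightarrow> f differentiable (at x) \<and> \<bar>deriv f x\<bar> = 1)) \<and>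
     (\<forall>x. \<not> x islimpt {y. \<not> isCont f y})"

end

theory Submission
  imports Defs
begin

text \<open>
  A permutation \<open>\<sigma>\<close> of the integers lifts to the piecewise rigid bijection of the line that
  translates each interval \<open>[n, n + 1)\<close> onto \<open>[\<sigma> n, \<sigma> n + 1)\<close>, so it suffices to decompose the
  integers. There any partition into four infinite sets \<open>A\<close>, \<open>B\<close>, \<open>C\<close>, \<open>D\<close> works: as the sets and
  their complements are all countably infinite, some permutation maps \<open>B\<close> onto the complement
  of \<open>A\<close>, and some permutation maps \<open>D\<close> onto the complement of \<open>C\<close>.
\<close>

text \<open>Since \<open>frac\<close> is kept and only the floor changes, composition of lifts
  mirrors composition of integer maps, so inverting a permutation inverts its lift.\<close>

definition lift_perm :: "(int \<Rightarrow> int) \<Rightarrow> real \<Rightarrow> real" where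
  "lift_perm \<sigma> x = of_int (\<sigma> \<lfloor>x\<rfloor>) + frac x"

lemma floor_lift_perm [simp]: "\<lfloor>lift_perm \<sigma> x\<rfloor> = \<sigma> \<lfloor>x\<rfloor>"
  unfolding lift_perm_def by (simp add: floor_eq_iff frac_lt_1)

lemma lift_perm_comp: "lift_perm \<sigma> (lift_perm \<tau> x) = lift_perm (\<sigma> \<circ> \<tau>) x"
  \<comment> \<open>Only the outer lift is unfolded first, so that \<open>floor_lift_perm\<close>
    can evaluate the floor of the inner one.\<close>
  by (simp add: lift_perm_def [of \<sigma>] frac_def) (simp add: lift_perm_def frac_def)

lemma lift_perm_id [simp]: "lift_perm id x = x"
  by (simp add: lift_perm_def frac_def)

lemma lift_perm_inv:
  assumes "bij \<sigma>"
  shows "lift_perm \<sigma> (lift_perm (inv \<sigma>) x) = x" "lift_perm (inv \<sigma>) (lift_perm \<sigma> x) = x"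
  using assms
  by (simp_all add: lift_perm_comp bij_is_inj bij_is_surj surj_iff [THEN iffD1])

lemma bij_lift_perm: "bij \<sigma> \<Longrightarrow> bij (lift_perm \<sigma>)"
  by (rule o_bij [of "lift_perm (inv \<sigma>)"]) (auto simp: lift_perm_inv fun_eq_iff)

lemma lift_perm_image_floor_vimage:
  assumes "bij \<sigma>"
  shows "lift_perm \<sigma> ` (floor -` S) = floor -` (\<sigma> ` S)"
proof (intro equalityI subsetI)
  fix x :: real assume "x \<in> floor -` (\<sigma> ` S)"
  then have "\<lfloor>lift_perm (inv \<sigma>) x\<rfloor> \<in> S"
    using assms by (auto simp: bij_is_inj)
  then show "x \<in> lift_perm \<sigma> ` (floor -` S)"
    using lift_perm_inv(1) [OF assms, of x] by (metis image_eqI vimageI)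
qed auto

lemma lift_perm_eq:
  assumes "of_int n \<le> x" "x < of_int n + 1"
  shows "lift_perm \<sigma> x = x + of_int (\<sigma> n - n)"
proof -
  have "\<lfloor>x\<rfloor> = n"
    using assms by linarith
  then show ?thesis
    by (simp add: lift_perm_def frac_def)
qed

lemma eventually_at_right_lift_perm:
  "\<forall>\<^sub>F y in at_right (of_int n). lift_perm \<sigma> y = y + of_int (\<sigma> n - n)"
  unfolding eventually_at_right_field
  by (rule exI [of _ "of_int n + 1"]) (auto simp: lift_perm_eq [of n])

text \<open>Just to the left of \<open>n\<close> the floor is \<open>n - 1\<close>, so the
  translation there is the one belonging to \<open>n - 1\<close>.\<close>

lemma eventually_at_left_lift_perm:
  "\<forall>\<^sub>F y in at_left (of_int n). lift_perm \<sigma> y = y + of_int (\<sigma> (n - 1) - (n - 1))"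
  unfolding eventually_at_left_field
  by (rule exI [of _ "of_int n - 1"]) (auto simp: lift_perm_eq [of "n - 1"])

text \<open>The left limit at \<open>n\<close> is \<open>\<sigma> (n - 1) + 1\<close> and the right
  limit is \<open>\<sigma> n\<close>.\<close>

lemma jump_discontinuity_lift_perm:
  assumes "\<sigma> n \<noteq> \<sigma> (n - 1) + 1"
  shows "jump_discontinuity (lift_perm \<sigma>) (of_int n)"
  unfolding jump_discontinuity_def
proof (intro exI conjI)
  show "(lift_perm \<sigma> \<longlongrightarrow> of_int n + of_int (\<sigma> (n - 1) - (n - 1))) (at_left (of_int n))"
    by (subst tendsto_cong [OF eventually_at_left_lift_perm]) (intro tendsto_intros)
  show "(lift_perm \<sigma> \<longlongrightarrow> of_int n + of_int (\<sigma> n - n)) (at_right (of_int n))"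
    by (subst tendsto_cong [OF eventually_at_right_lift_perm]) (intro tendsto_intros)
  show "of_int n + of_int (\<sigma> (n - 1) - (n - 1)) \<noteq> (of_int n + of_int (\<sigma> n - n) :: real)"
    using assms by (simp flip: of_int_add of_int_diff)
qed

text \<open>Near \<open>x\<close> the lift is a single translation: a non-integer lies inside one
  unit interval, and at an integer the hypothesis makes the translations on both sides
  agree.\<close>

lemma has_real_derivative_lift_perm:
  assumes "\<And>n. x = of_int n \<Longrightarrow> \<sigma> n = \<sigma> (n - 1) + 1"
  shows "(lift_perm \<sigma> has_real_derivative 1) (at x)"
proof -
  obtain a b c where ab: "a < x" "x < b"
    and eq: "\<And>y. \<lbrakk>a < y; y < b\<rbrakk> \<Longrightarrow> lift_perm \<sigma> y = y + c"
  proof (cases "x \<in> \<int>")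
    case True
    then obtain n where n: "x = of_int n"
      by (auto elim: Ints_cases)
    have "lift_perm \<sigma> y = y + of_int (\<sigma> n - n)" if "x - 1 < y" "y < x + 1" for y
    proof (cases "y < x")
      case True
      then show ?thesis
        using lift_perm_eq [of "n - 1" y \<sigma>] that assms [OF n] n by auto
    next
      case False
      then show ?thesis
        using lift_perm_eq [of n y \<sigma>] that n by auto
    qed
    then show thesis
      using that [of "x - 1" "x + 1"] by simp
  next
    case False
    then have "of_int \<lfloor>x\<rfloor> < x"
      by (metis Ints_of_int of_int_floor_le order_le_less)
    then show thesis
      using that [of "of_int \<lfloor>x\<rfloor>" "of_int \<lfloor>x\<rfloor> + 1"] lift_perm_eq [of "\<lfloor>x\<rfloor>" _ \<sigma>] by fastforce
  qed
  have "((\<lambda>y. y + c) has_real_derivative 1) (at x)"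
    by (auto intro!: derivative_eq_intros)
  then show ?thesis
    by (rule has_field_derivative_transform_within_open [of _ _ _ "{a<..<b}"]) (auto simp: ab eq)
qed

lemma piecewise_rigid_lift_perm:
  assumes "bij \<sigma>"
  shows "piecewise_rigid (lift_perm \<sigma>)"
  unfolding piecewise_rigid_def
proof (intro conjI exI ballI allI impI)
  \<comment> \<open>These are the integers at which the translation amount changes.\<close>
  let ?E = "of_int ` {n. \<sigma> n \<noteq> \<sigma> (n - 1) + 1} :: real set"
  have deriv: "(lift_perm \<sigma> has_real_derivative 1) (at x)" if "x \<notin> ?E" for x
    using that by (intro has_real_derivative_lift_perm) auto
  show "bij (lift_perm \<sigma>)"
    using assms by (rule bij_lift_perm)
  show "countable ?E"
    by simp
  show "jump_discontinuity (lift_perm \<sigma>) x" if "x \<in> ?E" for x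
    using that jump_discontinuity_lift_perm by auto
  show "lift_perm \<sigma> differentiable (at x)" if "x \<notin> ?E" for x
    using deriv [OF that] real_differentiable_def by blast
  show "\<bar>deriv (lift_perm \<sigma>) x\<bar> = 1" if "x \<notin> ?E" for x
    using deriv [OF that] by (simp add: DERIV_imp_deriv)
  \<comment> \<open>Discontinuities occur only at integers, and distinct integers are at distance at
    least 1, so they cannot accumulate.\<close>
  have "{y. \<not> isCont (lift_perm \<sigma>) y} \<subseteq> \<int>"
    using DERIV_isCont [OF deriv] by (auto simp: Ints_def)
  moreover have "\<not> x islimpt \<int>" for x :: real
  proof (rule discrete_imp_not_islimpt [of 1])
    show "y = x" if "x \<in> \<int>" "y \<in> \<int>" "dist y x < 1" for x y :: real
      using that by (auto elim!: Ints_cases simp: dist_real_def simp flip: of_int_diff)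
  qed simp
  ultimately show "\<not> x islimpt {y. \<not> isCont (lift_perm \<sigma>) y}" for x
    using islimpt_subset by blast
qed

lemma ex_bij_betw_countable_infinite:
  assumes "countable S" "infinite S" "countable T" "infinite T"
  shows "\<exists>f. bij_betw f S T"
  using assms by (meson bij_betw_from_nat_into bij_betw_inv_into bij_betw_trans)

text \<open>A bijection of \<open>S\<close> onto \<open>T\<close> is glued with one between the
  complements; both exist because all four sets are countably infinite.\<close>

lemma ex_bij_image_eq:
  fixes S T :: "'a :: countable set"
  assumes "infinite S" "infinite (- S)" "infinite T" "infinite (- T)"
  shows "\<exists>\<sigma>. bij \<sigma> \<and> \<sigma> ` S = T"
proof -
  obtain f where f: "bij_betw f S T"
    using ex_bij_betw_countable_infinite [of S T] assms by auto
  obtain f' where f': "bij_betw f' (- S) (- T)"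
    using ex_bij_betw_countable_infinite [of "- S" "- T"] assms by auto
  let ?\<sigma> = "\<lambda>x. if x \<in> S then f x else f' x"
  have "bij_betw ?\<sigma> (S \<union> - S) (T \<union> - T)"
    using f f' by (intro bij_betw_disjoint_Un) auto
  moreover have "?\<sigma> ` S = T"
    using f by (simp add: bij_betw_def)
  ultimately show ?thesis
    by auto
qed

lemma infinite_residue_class_int:
  assumes "0 \<le> r" "r < m"
  shows "infinite {n :: int. n mod m = r}"
proof -
  have "inj (\<lambda>k. m * int k + r)"
    using assms by (auto simp: inj_on_def)
  moreover have "range (\<lambda>k. m * int k + r) \<subseteq> {n. n mod m = r}"
    using assms by auto
  ultimately show ?thesis
    using infinite_UNIV_nat range_inj_infinite infinite_super by blast
qed

theorem theorem3p1:
  "\<exists>(g :: real \<Rightarrow> real) (h :: real \<Rightarrow> real) (A :: real set) B C D.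
     piecewise_rigid g \<and> piecewise_rigid h \<and>
     A \<union> B \<union> C \<union> D = UNIV \<and>
     A \<inter> B = {} \<and> A \<inter> C = {} \<and> A \<inter> D = {} \<and>
     B \<inter> C = {} \<and> B \<inter> D = {} \<and> C \<inter> D = {} \<and>
     A \<inter> g ` B = {} \<and> A \<union> g ` B = UNIV \<and>
     C \<inter> h ` D = {} \<and> C \<union> h ` D = UNIV"
proof -
  \<comment> \<open>The residue classes 0, 1, 2, 3 modulo 4 index the intervals forming
    \<open>A\<close>, \<open>B\<close>, \<open>C\<close>, \<open>D\<close> respectively.\<close>
  define R :: "int \<Rightarrow> int set" where "R r = {n. n mod 4 = r}" for r
  have inf: "infinite (R r)" if "0 \<le> r" "r < 4" for r
    unfolding R_def using that by (rule infinite_residue_class_int)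
  have disj: "R r \<inter> R s = {}" if "r \<noteq> s" for r s
    using that by (auto simp: R_def)
  \<comment> \<open>The complement of a class contains another infinite class: \<open>R 1\<close> if
    \<open>r = 0\<close>, and \<open>R 0\<close> otherwise.\<close>
  have inf_compl: "infinite (- R r)" for r
  proof (cases "r = 0")
    case True
    then show ?thesis
      using disj [of 0 1] inf [of 1] infinite_super [of "R 1" "- R r"] by auto
  next
    case False
    then show ?thesis
      using disj [of 0 r] inf [of 0] infinite_super [of "R 0" "- R r"] by auto
  qed
  obtain \<sigma> where \<sigma>: "bij \<sigma>" "\<sigma> ` R 1 = - R 0"
    using ex_bij_image_eq [of "R 1" "- R 0"] inf inf_compl by auto
  obtain \<tau> where \<tau>: "bij \<tau>" "\<tau> ` R 3 = - R 2"
    using ex_bij_image_eq [of "R 3" "- R 2"] inf inf_compl by auto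
  let ?P = "\<lambda>r. floor -` R r :: real set"
  have "n \<in> R 0 \<union> R 1 \<union> R 2 \<union> R 3" for n
    by (auto simp: R_def)
  then have "?P 0 \<union> ?P 1 \<union> ?P 2 \<union> ?P 3 = UNIV"
    by (simp add: set_eq_iff)
  moreover have "?P r \<inter> ?P s = {}" if "r \<noteq> s" for r s
    using disj [OF that] by auto
  \<comment> \<open>Each image being an exact complement yields both the disjointness and the
    covering demanded of it.\<close>
  moreover have "lift_perm \<sigma> ` ?P 1 = - ?P 0" "lift_perm \<tau> ` ?P 3 = - ?P 2"
    using \<sigma> \<tau> by (simp_all add: lift_perm_image_floor_vimage vimage_Compl)
  ultimately show ?thesis
    using \<sigma>(1) \<tau>(1)
    by (intro exI [of _ "lift_perm \<sigma>"] exI [of _ "lift_perm \<tau>"]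
        exI [of _ "?P 0"] exI [of _ "?P 1"] exI [of _ "?P 2"] exI [of _ "?P 3"])
      (simp add: piecewise_rigid_lift_perm)
qed

end
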